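(* For any integer $k\ge 3$ and real $\varepsilon>0$ there exists $n_0=n_0(\varepsilon)$ such that if $n\ge n_0$ and $\mathcal{F}\subseteq\tilde{B}_n$ with $|\mathcal{F}|=(1+\varepsilon)\binom{n}{\lfloor n/2\rfloor}$, then $\mathcal{F}$ contains a strong copy $\mathcal{G}$ of $P_{2k-1}$, given by a bijection $p\mapsto G_p$, such that $G_{a_i}\not\subseteq G_{a_1}\cup G_{a_k}$ for all $i=2,\dots,k-1$.
   Context: $[n]=\{1,\dots,n\}$ and $\tilde{B}_n=\{F\subseteq[n]: ||F|-n/2|\le 2\sqrt{n\ln n}\}$. A family $\mathcal{G}$ is a strong copy of a poset $(P,\leqslant)$ if there is a bijection $f:P\to\mathcal{G}$ with $p\leqslant q\iff f(p)\subseteq f(q)$; we write $G_p=f(p)$. $P_{2k-1}$ is the poset on $2k-1$ elements $a_1,\dots,a_k,b_1,\dots,b_{k-1}$ whose only relations are $a_i<b_i$ and $a_{i+1}<b_i$ for $i=1,\dots,k-1$. *)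

theory Defs
  imports Complex_Main
begin

text \<open>The ground set is \<open>[n] = {1..n}\<close>.\<close>

definition B_tilde :: "nat \<Rightarrow> nat set set" where
  "B_tilde n =
    {F. F \<subseteq> {1..n} \<and> \<bar>real (card F) - real n / 2\<bar> \<le> 2 * sqrt (real n * ln (real n))}"

text \<open>A poset is given by its carrier \<open>P\<close> and its order relation \<open>r\<close>, a set of pairs with
  \<open>partial_order_on P r\<close>.\<close>

definition strong_copy_via ::
    "'p set \<Rightarrow> 'p rel \<Rightarrow> ('p \<Rightarrow> 'a set) \<Rightarrow> 'a set set \<Rightarrow> bool" where
  "strong_copy_via P r f G \<longleftrightarrow>
    bij_betw f P G \<and> (\<forall>p\<in>P. \<forall>q\<in>P. (p, q) \<in> r \<longleftrightarrow> f p \<subseteq> f q)"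

text \<open>The poset \<open>P\<^sub>2\<^sub>k\<^sub>-\<^sub>1\<close>, with \<open>a\<^sub>i\<close> and \<open>b\<^sub>i\<close> written \<open>A i\<close> and \<open>B i\<close>.\<close>

datatype fence_elem = A nat | B nat

definition fence :: "nat \<Rightarrow> fence_elem set" where
  "fence k = A ` {1..k} \<union> B ` {1..k - 1}"

definition fence_order :: "nat \<Rightarrow> fence_elem rel" where
  "fence_order k =
    Id_on (fence k) \<union> {(A i, B i) | i. i \<in> {1..k - 1}} \<union> {(A (i + 1), B i) | i. i \<in> {1..k - 1}}"

lemma card_fence: "k \<ge> 1 \<Longrightarrow> card (fence k) = 2 * k - 1"
  unfolding fence_def
  by (subst card_Un_disjoint) (auto simp: card_image inj_on_def)

lemma partial_order_on_fence: "partial_order_on (fence k) (fence_order k)"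
  unfolding partial_order_on_def preorder_on_def
  by (auto simp: fence_order_def fence_def refl_on_def trans_def antisym_def)

end

theory Submission
  imports Defs "HOL-Combinatorics.Permutations" "HOL-Real_Asymp.Real_Asymp"
begin

text \<open>
  Read a permutation \<open>p\<close> of \<open>{1..n}\<close> as the maximal chain of its initial images \<open>p ` {1..i}\<close>.
  A chain with \<open>x\<close> members of \<open>F\<close> has at least \<open>x - 1\<close> pairs of consecutive members, and a random
  chain has at least \<open>1 + \<epsilon>\<close> members on average, so consecutive pairs carry a fixed proportion of
  the weight of the members. Pruning yields a relation \<open>H\<close> in which, from every lower (upper) member,
  a random chain continues to an \<open>H\<close>-neighbour above (below) with probability at least \<open>\<delta>\<close>.

  As all sizes differ by \<open>O(sqrt (n ln n)) = o(n)\<close>, such a step creates an unwanted comparability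
  with boundedly many given sets only with probability \<open>o(1)\<close>, so every tree embeds as an induced
  subposet. Embed a spider with many legs of length \<open>k - 2\<close> ending in upper members. The sets below a
  given leaf that could serve as an end of the fence omit, between them, at least
  \<open>\<delta> n / 8\<close> points \<open>y\<close> of the leaf, most of which lie in all sets of the spider; by pigeonhole two legs share such a \<open>y\<close>. The path
  along these legs is the fence: \<open>y\<close> lies in all its sets but the two ends \<open>a\<^sub>1\<close> and \<open>a\<^sub>k\<close>.
\<close>

section \<open>Maximal chains as permutations\<close>

definition through :: "nat \<Rightarrow> nat set \<Rightarrow> (nat \<Rightarrow> nat) set" where
  "through n X = {p. p permutes {1..n} \<and> p ` {1..card X} = X}"

text \<open>Chains on which \<open>Y\<close> is the next member of \<open>F\<close> after
  \<open>X\<close>. For fixed \<open>X\<close> and different \<open>Y\<close> in \<open>F\<close>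
  these sets are disjoint, so their cardinalities add up to probabilities, which would fail for
  arbitrary comparable pairs.\<close>

definition consec :: "nat \<Rightarrow> nat set set \<Rightarrow> nat set \<Rightarrow> nat set \<Rightarrow> (nat \<Rightarrow> nat) set" where
  "consec n F X Y = {p \<in> through n X \<inter> through n Y.
    X \<subset> Y \<and> (\<forall>Z\<in>F. p \<in> through n Z \<longrightarrow> \<not> (X \<subset> Z \<and> Z \<subset> Y))}"

lemma finite_through [simp]: "finite (through n X)"
  unfolding through_def by (rule finite_subset[OF _ finite_permutations[of "{1..n}"]]) auto

lemma consec_subset: "consec n F X Y \<subseteq> through n X" "consec n F X Y \<subseteq> through n Y"
  unfolding consec_def by auto

lemma finite_consec [simp]: "finite (consec n F X Y)"
  by (rule finite_subset[OF consec_subset(1)]) simp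

lemma through_mono:
  assumes "p \<in> through n X" "p \<in> through n Y" "card X \<le> card Y"
  shows "X \<subseteq> Y"
proof -
  have "p ` {1..card X} \<subseteq> p ` {1..card Y}" using assms(3) by (intro image_mono) auto
  then show ?thesis using assms(1,2) by (simp add: through_def)
qed

lemma through_chain:
  assumes "p \<in> through n X" "p \<in> through n Y"
  shows "X \<subseteq> Y \<or> Y \<subseteq> X"
  using through_mono assms by (meson nat_le_linear)

text \<open>Two sets on one chain are comparable, and if they differed, the smaller one would lie
  strictly between \<open>X\<close> and the larger one.\<close>

lemma consec_unique_upper:
  assumes "p \<in> consec n F X Y" "p \<in> consec n F X Y'" "Y \<in> F" "Y' \<in> F"
  shows "Y = Y'"
  using assms through_chain[of p n Y Y'] unfolding consec_def by blast

lemma consec_unique_lower: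
  assumes "p \<in> consec n F X Y" "p \<in> consec n F X' Y" "X \<in> F" "X' \<in> F"
  shows "X = X'"
  using assms through_chain[of p n X X'] unfolding consec_def by blast

text \<open>Glue a bijection from \<open>X\<close> to \<open>Y\<close> with one between the
  complements in \<open>S\<close>, which also have equal size.\<close>

lemma ex_permutes_image_eq:
  assumes "finite S" "X \<subseteq> S" "Y \<subseteq> S" "card X = card Y"
  shows "\<exists>q. q permutes S \<and> q ` X = Y"
proof -
  have fin: "finite X" "finite Y" using assms finite_subset by auto
  obtain f where f: "bij_betw f X Y"
    using fin assms(4) finite_same_card_bij by blast
  have "card (S - X) = card (S - Y)" using assms fin by (simp add: card_Diff_subset)
  then obtain g where g: "bij_betw g (S - X) (S - Y)"
    using assms(1) finite_same_card_bij by blast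
  define q where "q x = (if x \<in> X then f x else if x \<in> S then g x else x)" for x
  have qX: "bij_betw q X Y" using f by (rule bij_betw_cong[THEN iffD1, rotated]) (auto simp: q_def)
  have qS: "bij_betw q (S - X) (S - Y)"
    using g by (rule bij_betw_cong[THEN iffD1, rotated]) (auto simp: q_def)
  have "bij_betw q (X \<union> (S - X)) (Y \<union> (S - Y))"
    using qX qS by (rule bij_betw_combine) auto
  moreover have "X \<union> (S - X) = S" "Y \<union> (S - Y) = S" using assms by auto
  ultimately have "q permutes S" by (intro bij_imp_permutes) (use assms in \<open>auto simp: q_def\<close>)
  then show ?thesis using qX by (auto simp: bij_betw_def)
qed

lemma through_compose:
  assumes "q permutes {1..n}" "p \<in> through n X"
  shows "q \<circ> p \<in> through n (q ` X)"
proof -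
  have "card (q ` X) = card X"
    using permutes_inj_on[OF assms(1)] by (rule card_image)
  moreover have "(q \<circ> p) ` {1..card X} = q ` X"
    using assms(2) unfolding image_comp[symmetric] through_def by simp
  ultimately show ?thesis
    using assms by (simp add: through_def permutes_compose)
qed

text \<open>Composition with a permutation carrying \<open>X\<close> to \<open>Y\<close> injects the
  chains through \<open>X\<close> into those through \<open>Y\<close>. By symmetry, the count
  depends on the size only.\<close>

lemma card_through_le:
  assumes "X \<subseteq> {1..n}" "Y \<subseteq> {1..n}" "card X = card Y"
  shows "card (through n X) \<le> card (through n Y)"
proof -
  obtain q where q: "q permutes {1..n}" "q ` X = Y"
    using ex_permutes_image_eq[OF _ assms] by auto
  have "(\<lambda>p. q \<circ> p) ` through n X \<subseteq> through n Y"
    using q through_compose by blast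
  moreover have "inj_on (\<lambda>p. q \<circ> p) (through n X)"
    using inj_on_subset[OF fun.inj_map[OF permutes_inj[OF q(1)]]] by simp
  ultimately show ?thesis by (meson card_inj_on_le finite_through)
qed

text \<open>Every permutation passes through exactly one set of size \<open>card X\<close>, and all
  these sets lie on equally many chains. A random chain thus meets \<open>X\<close> with probability
  \<open>1 / (n choose card X)\<close>.\<close>

lemma card_through:
  assumes "X \<subseteq> {1..n}"
  shows "card (through n X) * (n choose card X) = fact n"
proof -
  let ?I = "{Y. Y \<subseteq> {1..n} \<and> card Y = card X}"
  have le: "card X \<le> n" using card_mono[OF _ assms] by simp
  have "{p. p permutes {1..n}} = (\<Union>Y\<in>?I. through n Y)"
  proof (intro set_eqI iffI)
    fix p assume "p \<in> {p. p permutes {1..n}}"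
    then have p: "p permutes {1..n}" by simp
    have "p ` {1..card X} \<subseteq> {1..n}" using permutes_image[OF p] le by fastforce
    moreover have "card (p ` {1..card X}) = card X"
      using card_image[of p "{1..card X}"] permutes_inj_on[OF p] by simp
    ultimately show "p \<in> (\<Union>Y\<in>?I. through n Y)" using p by (auto simp: through_def)
  qed (auto simp: through_def)
  then have "fact n = card (\<Union>Y\<in>?I. through n Y)"
    using card_permutations[of "{1..n}" n] by simp
  also have "\<dots> = (\<Sum>Y\<in>?I. card (through n Y))"
    by (rule card_UN_disjoint) (auto, auto simp: through_def)
  also have "\<dots> = (\<Sum>Y\<in>?I. card (through n X))"
    by (rule sum.cong) (use assms card_through_le in \<open>auto intro!: antisym\<close>)
  also have "\<dots> = card (through n X) * (n choose card X)"
    using n_subsets[of "{1..n}" "card X"] by simp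
  finally show ?thesis by simp
qed

lemma card_through_pos: "X \<subseteq> {1..n} \<Longrightarrow> 0 < card (through n X)"
  using card_through[of X n] by (metis fact_nonzero gr0I mult_0)

section \<open>Entries of a random chain through a given set\<close>

lemma through_above:
  assumes "p \<in> through n X" "i \<in> {card X<..n}"
  shows "p i \<in> {1..n} - X"
proof -
  have p: "p permutes {1..n}" "p ` {1..card X} = X" using assms by (auto simp: through_def)
  have "p i \<in> {1..n}" using permutes_in_image[OF p(1)] assms(2) by auto
  moreover have "p i \<notin> p ` {1..card X}"
    using assms(2) inj_image_mem_iff[OF permutes_inj[OF p(1)]] by auto
  ultimately show ?thesis using p by auto
qed

lemma through_below:
  assumes "p \<in> through n X" "i \<in> {1..card X}"
  shows "p i \<in> X"
  using assms by (auto simp: through_def)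

text \<open>Composing with transpositions of \<open>T\<close> shows that \<open>p i\<close> is uniformly distributed on \<open>T\<close> over
  the chains through \<open>X\<close>.\<close>

lemma card_through_at:
  assumes X: "X \<subseteq> {1..n}" and T: "T = X \<or> T = {1..n} - X" and x: "x \<in> T"
    and i: "\<And>p. p \<in> through n X \<Longrightarrow> p i \<in> T"
  shows "card {p \<in> through n X. p i = x} * card T = card (through n X)"
proof -
  have le: "card {p \<in> through n X. p i = a} \<le> card {p \<in> through n X. p i = b}"
    if ab: "a \<in> T" "b \<in> T" for a b
  proof -
    have q: "transpose a b permutes {1..n}"
      using ab T X by (intro permutes_swap_id) auto
    have qX: "transpose a b ` X = X"
      using ab T by (auto simp: transpose_def image_def)
    have "(\<lambda>p. transpose a b \<circ> p) ` {p \<in> through n X. p i = a} \<subseteq> {p \<in> through n X. p i = b}"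
    proof (intro image_subsetI CollectI conjI)
      fix p assume p: "p \<in> {p \<in> through n X. p i = a}"
      show "transpose a b \<circ> p \<in> through n X" using through_compose[OF q, of p X] p qX by simp
      show "(transpose a b \<circ> p) i = b" using p by simp
    qed
    moreover have "inj_on (\<lambda>p. transpose a b \<circ> p) {p \<in> through n X. p i = a}"
      using inj_on_subset[OF fun.inj_map[OF permutes_inj[OF q]]] by simp
    ultimately show ?thesis by (intro card_inj_on_le) auto
  qed
  have "through n X = (\<Union>y\<in>T. {p \<in> through n X. p i = y})" using i by auto
  then have "card (through n X) = card (\<Union>y\<in>T. {p \<in> through n X. p i = y})" by simp
  also have "\<dots> = (\<Sum>y\<in>T. card {p \<in> through n X. p i = y})"
    by (rule card_UN_disjoint) (use T X finite_subset in auto)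
  also have "\<dots> = (\<Sum>y\<in>T. card {p \<in> through n X. p i = x})"
    by (rule sum.cong) (use le x in \<open>auto intro!: antisym\<close>)
  finally show ?thesis by simp
qed

text \<open>A union bound: each event \<open>p i = x\<close> has probability
  \<open>1 / card T\<close> among the chains through \<open>X\<close>, and
  \<open>card K + card Y\<close> such events cover \<open>S\<close>, which has probability at least
  \<open>\<delta>\<close>. When few exceptional events \<open>K\<close> are listed, the set
  \<open>Y\<close> of values at position \<open>j\<close> must be large.\<close>

lemma card_hits_ge:
  fixes \<delta> :: real
  assumes X: "X \<subseteq> {1..n}" and T: "T = X \<or> T = {1..n} - X"
    and I: "\<And>p i. p \<in> through n X \<Longrightarrow> i \<in> I \<Longrightarrow> p i \<in> T"
    and S: "S \<subseteq> through n X" "\<delta> * card (through n X) \<le> card S"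
    and K: "finite K" "K \<subseteq> I \<times> T" and j: "j \<in> I" and Y: "Y \<subseteq> T"
    and hit: "\<And>p. p \<in> S \<Longrightarrow> (\<exists>(i, x)\<in>K. p i = x) \<or> p j \<in> Y"
  shows "\<delta> * card T \<le> card K + card Y"
proof -
  let ?N = "card (through n X)"
  let ?E = "\<lambda>(i, x). {p \<in> through n X. p i = x}"
  define L where "L = K \<union> {j} \<times> Y"
  have fT: "finite T" using X T finite_subset by auto
  have fL: "finite L" using K(1) Y fT finite_subset by (auto simp: L_def)
  have L: "card (?E z) * card T = ?N" if "z \<in> L" for z
    using that K(2) j Y card_through_at[OF X T, of "snd z" "fst z"] I
    by (auto simp: L_def case_prod_unfold)
  have "S \<subseteq> (\<Union>z\<in>L. ?E z)" using S(1) hit by (fastforce simp: L_def)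
  then have "card S \<le> card (\<Union>z\<in>L. ?E z)"
    by (rule card_mono[rotated]) (use fL in auto)
  also have "\<dots> \<le> (\<Sum>z\<in>L. card (?E z))" using fL by (rule card_UN_le)
  finally have "card S * card T \<le> (\<Sum>z\<in>L. card (?E z)) * card T" by simp
  also have "\<dots> = card L * ?N" using L by (simp add: sum_distrib_right)
  finally have 1: "real (card S) * card T \<le> real (card L) * ?N" by (metis of_nat_le_iff of_nat_mult)
  have "?N * (\<delta> * card T) \<le> real (card S) * card T"
    using mult_right_mono[OF S(2), of "real (card T)"] by (simp add: algebra_simps)
  also note 1
  finally have "?N * (\<delta> * card T) \<le> ?N * card L" by (simp add: algebra_simps)
  then have "\<delta> * card T \<le> card L" using card_through_pos[OF X] by simp
  also have "card L \<le> card K + card ({j} \<times> Y)" unfolding L_def by (rule card_Un_le)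
  finally show ?thesis by (simp add: card_cartesian_product)
qed

section \<open>Pruning a weighted bipartite graph\<close>

text \<open>The subgraph is a maximiser of edge weight minus vertex weight.\<close>

lemma ex_min_degree_subgraph:
  fixes w :: "'a \<times> 'b \<Rightarrow> real" and \<mu> :: "'a \<Rightarrow> real" and \<nu> :: "'b \<Rightarrow> real"
  assumes E: "finite E" and w: "sum \<mu> (fst ` E) + sum \<nu> (snd ` E) < sum w E"
    and pos: "\<And>x. 0 \<le> \<mu> x" "\<And>y. 0 \<le> \<nu> y"
  obtains H where "H \<subseteq> E" "H \<noteq> {}"
    "\<And>x y. (x, y) \<in> H \<Longrightarrow> \<mu> x \<le> (\<Sum>y' | (x, y') \<in> H. w (x, y'))"
    "\<And>x y. (x, y) \<in> H \<Longrightarrow> \<nu> y \<le> (\<Sum>x' | (x', y) \<in> H. w (x', y))"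
proof -
  define \<Phi> where "\<Phi> H = sum w H - sum \<mu> (fst ` H) - sum \<nu> (snd ` H)" for H
  have "finite (\<Phi> ` Pow E)" "\<Phi> ` Pow E \<noteq> {}" using E by auto
  then obtain H where H: "H \<in> Pow E" and max: "\<And>H'. H' \<in> Pow E \<Longrightarrow> \<Phi> H' \<le> \<Phi> H"
    using Max_in[of "\<Phi> ` Pow E"] Max_ge[of "\<Phi> ` Pow E"]
    by (smt (verit, best) imageE imageI)
  have fH: "finite H" using H E finite_subset by auto
  have "0 < \<Phi> E" using w by (simp add: \<Phi>_def)
  \<comment> \<open>The empty relation has value 0, whereas the maximum is at least the positive
    value of \<open>E\<close>.\<close>
  then have "\<Phi> H \<noteq> 0" using max[of E] by auto
  then have ne: "H \<noteq> {}" by (auto simp: \<Phi>_def)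
  show thesis
  proof (rule that[of H])
    fix x y assume xy: "(x, y) \<in> H"
    \<comment> \<open>Deleting all edges at \<open>x\<close> loses their weight, saves
      \<open>\<mu> x\<close>, and can only lower the cost on the other side. If the weight lost were
      below \<open>\<mu> x\<close>, the value would increase.\<close>
    define R where "R = {z \<in> H. fst z = x}"
    have R: "R = Pair x ` {y'. (x, y') \<in> H}" by (force simp: R_def)
    have "sum w R = (\<Sum>y' | (x, y') \<in> H. w (x, y'))"
      unfolding R by (subst sum.reindex) (auto simp: inj_on_def)
    moreover have "\<Phi> (H - R) \<le> \<Phi> H" using max[of "H - R"] H by blast
    moreover have "fst ` (H - R) = fst ` H - {x}" by (force simp: R_def)
    then have "sum \<mu> (fst ` (H - R)) = sum \<mu> (fst ` H) - \<mu> x"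
      using xy fH by (simp add: sum_diff1 image_iff) force
    moreover have "sum \<nu> (snd ` (H - R)) \<le> sum \<nu> (snd ` H)"
      using fH pos by (intro sum_mono2) auto
    moreover have "sum w (H - R) = sum w H - sum w R"
      using fH by (intro sum_diff) (auto simp: R_def)
    ultimately show "\<mu> x \<le> (\<Sum>y' | (x, y') \<in> H. w (x, y'))" by (simp add: \<Phi>_def)
  next
    fix x y assume xy: "(x, y) \<in> H"
    define R where "R = {z \<in> H. snd z = y}"
    have R: "R = (\<lambda>x'. (x', y)) ` {x'. (x', y) \<in> H}" by (force simp: R_def)
    have "sum w R = (\<Sum>x' | (x', y) \<in> H. w (x', y))"
      unfolding R by (subst sum.reindex) (auto simp: inj_on_def)
    moreover have "\<Phi> (H - R) \<le> \<Phi> H" using max[of "H - R"] H by blast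
    moreover have "snd ` (H - R) = snd ` H - {y}" by (force simp: R_def)
    then have "sum \<nu> (snd ` (H - R)) = sum \<nu> (snd ` H) - \<nu> y"
      using xy fH by (simp add: sum_diff1 image_iff) force
    moreover have "sum \<mu> (fst ` (H - R)) \<le> sum \<mu> (fst ` H)"
      using fH pos by (intro sum_mono2) auto
    moreover have "sum w (H - R) = sum w H - sum w R"
      using fH by (intro sum_diff) (auto simp: R_def)
    ultimately show "\<nu> y \<le> (\<Sum>x' | (x', y) \<in> H. w (x', y))" by (simp add: \<Phi>_def)
  qed (use H ne in auto)
qed

section \<open>Double counting members and consecutive pairs on chains\<close>

lemma sum_card_swap:
  assumes "finite S" "finite T"
  shows "(\<Sum>x\<in>S. card {y \<in> T. R x y}) = (\<Sum>y\<in>T. card {x \<in> S. R x y})"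
proof -
  have "(\<Sum>x\<in>S. card {y \<in> T. R x y}) = (\<Sum>x\<in>S. \<Sum>y\<in>T. if R x y then 1 else 0)"
    using assms by (simp add: sum.inter_filter[symmetric])
  also have "\<dots> = (\<Sum>y\<in>T. \<Sum>x\<in>S. if R x y then 1 else 0)" by (rule sum.swap)
  also have "\<dots> = (\<Sum>y\<in>T. card {x \<in> S. R x y})"
    using assms by (simp add: sum.inter_filter[symmetric])
  finally show ?thesis .
qed

text \<open>On each chain, every member of \<open>F\<close> except the largest is the lower end of a
  consecutive pair. Summing over all \<open>fact n\<close> chains and exchanging the sums gives the
  bound.\<close>

lemma sum_card_through_le:
  assumes F: "finite F"
  shows "(\<Sum>X\<in>F. card (through n X))
    \<le> fact n + (\<Sum>(X, Y)\<in>{(X, Y). X \<in> F \<and> Y \<in> F \<and> X \<subset> Y}. card (consec n F X Y))"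
proof -
  let ?\<Omega> = "{p. p permutes {1..n}}"
  let ?E = "{(X, Y). X \<in> F \<and> Y \<in> F \<and> X \<subset> Y}"
  define Fp where "Fp p = {X \<in> F. p \<in> through n X}" for p
  define Pp where "Pp p = {(X, Y) \<in> ?E. p \<in> consec n F X Y}" for p
  have fO: "finite ?\<Omega>" by (simp add: finite_permutations)
  have fE: "finite ?E" by (rule finite_subset[of _ "F \<times> F"]) (use F in auto)
  have fP: "finite (Pp p)" for p unfolding Pp_def by (rule finite_subset[OF _ fE]) auto
  have le: "card (Fp p) \<le> 1 + card (Pp p)" for p
  proof (cases "Fp p = {}")
    case False
    have fF: "finite (Fp p)" using F by (simp add: Fp_def)
    have "Max (card ` Fp p) \<in> card ` Fp p" using False fF by (intro Max_in) auto
    then obtain M where M: "M \<in> Fp p" "\<And>X. X \<in> Fp p \<Longrightarrow> card X \<le> card M"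
      using fF by (auto simp: image_iff) (metis Max_ge finite_imageI imageI)
    have "Fp p - {M} \<subseteq> fst ` Pp p"
    proof
      fix X assume X: "X \<in> Fp p - {M}"
      then have XM: "X \<subset> M" using M through_mono[of p n X M] by (auto simp: Fp_def)
      \<comment> \<open>The successor of \<open>X\<close> on the chain is a member properly above
        \<open>X\<close> of least size.\<close>
      define c where "c = (LEAST c. \<exists>Y\<in>Fp p. X \<subset> Y \<and> card Y = c)"
      have ex: "\<exists>c. \<exists>Y\<in>Fp p. X \<subset> Y \<and> card Y = c" using XM M by auto
      then obtain Y where Y: "Y \<in> Fp p" "X \<subset> Y" "card Y = c"
        using LeastI_ex[OF ex] unfolding c_def by blast
      have "\<not> (X \<subset> Z \<and> Z \<subset> Y)" if "Z \<in> F" "p \<in> through n Z" for Z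
      proof
        assume Z: "X \<subset> Z \<and> Z \<subset> Y"
        have "Z \<in> Fp p" using that by (simp add: Fp_def)
        then have "c \<le> card Z" unfolding c_def using Z by (intro Least_le) auto
        moreover have "Y \<subseteq> Z" if "card Y \<le> card Z"
          using that Y \<open>p \<in> through n Z\<close> by (intro through_mono[of p n]) (auto simp: Fp_def)
        ultimately show False using Y(3) Z by blast
      qed
      then have "(X, Y) \<in> Pp p" using X Y by (auto simp: Pp_def consec_def Fp_def)
      then show "X \<in> fst ` Pp p" by force
    qed
    then have "card (Fp p - {M}) \<le> card (Pp p)"
      using fP by (meson card_image_le card_mono finite_imageI le_trans)
    then show ?thesis using M fF by (simp add: card_Diff_singleton)
  qed simp
  have "through n X = {p \<in> ?\<Omega>. p \<in> through n X}" for X by (auto simp: through_def)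
  then have "(\<Sum>X\<in>F. card (through n X)) = (\<Sum>X\<in>F. card {p \<in> ?\<Omega>. p \<in> through n X})"
    by simp
  also have "\<dots> = (\<Sum>p\<in>?\<Omega>. card (Fp p))"
    unfolding Fp_def using F fO by (rule sum_card_swap)
  also have "\<dots> \<le> (\<Sum>p\<in>?\<Omega>. 1 + card (Pp p))" by (intro sum_mono le)
  also have "\<dots> = fact n + (\<Sum>p\<in>?\<Omega>. card (Pp p))"
    unfolding sum.distrib using card_permutations[of "{1..n}" n] by simp
  also have "(\<Sum>p\<in>?\<Omega>. card (Pp p))
      = (\<Sum>p\<in>?\<Omega>. card {z \<in> ?E. p \<in> consec n F (fst z) (snd z)})"
    by (simp add: Pp_def case_prod_unfold)
  also have "\<dots> = (\<Sum>z\<in>?E. card {p \<in> ?\<Omega>. p \<in> consec n F (fst z) (snd z)})"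
    using fO fE by (rule sum_card_swap)
  also have "\<dots> = (\<Sum>z\<in>?E. card (consec n F (fst z) (snd z)))"
    by (intro sum.cong refl arg_cong[where f = card]) (auto simp: consec_def through_def)
  finally show ?thesis by (simp add: case_prod_unfold)
qed

section \<open>Dense relations and their extension by one set\<close>

text \<open>The outcome of the pruning. The degree conditions say that the next member of
  \<open>F\<close> above (below) a set on a random chain through it is an \<open>H\<close>-neighbour
  with probability at least \<open>\<delta>\<close>. The size bounds keep each member and its
  complement at \<open>n / 4\<close> points or more, and \<open>D\<close> bounds all differences of
  sizes.\<close>

locale dense_pairs =
  fixes n D :: nat and \<delta> :: real and F :: "nat set set" and H :: "nat set rel"
  assumes subset_ground: "X \<in> F \<Longrightarrow> X \<subseteq> {1..n}"
    and size_ge: "X \<in> F \<Longrightarrow> n \<le> 4 * card X"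
    and size_le: "X \<in> F \<Longrightarrow> 4 * card X \<le> 3 * n"
    and spread: "X \<in> F \<Longrightarrow> Y \<in> F \<Longrightarrow> card Y \<le> card X + D"
    and pairs: "(X, Y) \<in> H \<Longrightarrow> X \<in> F \<and> Y \<in> F \<and> X \<subset> Y"
    and nonempty: "H \<noteq> {}"
    and delta_pos: "0 < \<delta>"
    and up_degree: "(X, Y) \<in> H \<Longrightarrow>
      \<delta> * card (through n X) \<le> (\<Sum>Y' | (X, Y') \<in> H. card (consec n F X Y'))"
    and down_degree: "(X, Y) \<in> H \<Longrightarrow>
      \<delta> * card (through n Y) \<le> (\<Sum>X' | (X', Y) \<in> H. card (consec n F X' Y))"
begin

lemma finite_F: "finite F"
  by (rule finite_subset[of _ "Pow {1..n}"]) (use subset_ground in auto)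

lemma finite_member: "X \<in> F \<Longrightarrow> finite X"
  using subset_ground finite_subset by blast

lemma n_pos: "0 < n"
proof -
  obtain X Y where "(X, Y) \<in> H" using nonempty by auto
  then have "X \<in> F" "Y \<in> F" "X \<subset> Y" using pairs by auto
  then show ?thesis using subset_ground by fastforce
qed

lemma card_Diff_le: "X \<in> F \<Longrightarrow> Y \<in> F \<Longrightarrow> X \<subseteq> Y \<Longrightarrow> card (Y - X) \<le> D"
  using spread[of X Y] finite_member by (simp add: card_Diff_subset)

text \<open>A chain through \<open>X\<close> reaches an \<open>H\<close>-neighbour with probability
  at least \<open>\<delta>\<close>, while at most \<open>2 * D * card C\<close> events
  \<open>p i = x\<close> cover all the chains whose neighbour is comparable to another set of
  \<open>C\<close>. Minimality of \<open>X\<close> provides, for each other \<open>Z\<close> in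
  \<open>C\<close>, a point of \<open>Z\<close> outside \<open>X\<close>.\<close>

lemma extend_up:
  assumes C: "finite C" "C \<subseteq> F" and X: "X \<in> Domain H"
    and min: "\<And>Z. Z \<in> C \<Longrightarrow> Z \<subseteq> X \<Longrightarrow> Z = X"
    and small: "16 * real D * card C \<le> \<delta> * n"
  shows "\<exists>Y. (X, Y) \<in> H \<and> (\<forall>Z\<in>C - {X}. \<not> Z \<subseteq> Y \<and> \<not> Y \<subseteq> Z)"
proof -
  define good where "good Y \<longleftrightarrow> (X, Y) \<in> H \<and> (\<forall>Z\<in>C - {X}. \<not> Z \<subseteq> Y \<and> \<not> Y \<subseteq> Z)" for Y
  define T where "T = {1..n} - X"
  define I where "I = {card X<..n}"
  define x where "x Z = (SOME x. x \<in> Z - X)" for Z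
  have XF: "X \<in> F" and ltn: "card X < n"
  proof -
    obtain Y where "(X, Y) \<in> H" using X by auto
    then have Y: "X \<in> F" "Y \<in> F" "X \<subset> Y" using pairs by auto
    then show "X \<in> F" by simp
    have "card X < card Y" using Y finite_member psubset_card_mono by blast
    also have "card Y \<le> n" using card_mono[OF _ subset_ground[OF Y(2)]] by simp
    finally show "card X < n" .
  qed
  have x: "x Z \<in> Z - X" if "Z \<in> C" "Z \<noteq> X" for Z
  proof -
    have "\<exists>x. x \<in> Z - X" using min[OF that(1)] that(2) by blast
    then show ?thesis unfolding x_def by (rule someI_ex)
  qed
  \<comment> \<open>A chain leading to a bad \<open>Y\<close> either picks the witness \<open>x Z\<close> of \<open>\<not> Z \<subseteq> X\<close> within \<open>D\<close> steps
    (if \<open>Z \<subseteq> Y\<close>) or starts inside some \<open>Z \<supset> X\<close> (if \<open>Y \<subseteq> Z\<close>).\<close>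
  define K where "K = (\<Union>Z\<in>C - {X}. (I \<inter> {card X<..card X + D}) \<times> {x Z}) \<union>
    (\<Union>Z\<in>{Z \<in> C. X \<subset> Z}. {card X + 1} \<times> (Z - X))"
  define V where "V = {y \<in> T. \<exists>Y. good Y \<and> y \<in> Y}"
  let ?N = "{Y. (X, Y) \<in> H}"
  define S where "S = (\<Union>Y\<in>?N. consec n F X Y)"
  have fN: "finite ?N" by (rule finite_subset[OF _ finite_F]) (use pairs in auto)
  have "card S = (\<Sum>Y\<in>?N. card (consec n F X Y))" unfolding S_def
  proof (rule card_UN_disjoint)
    show "\<forall>Y\<in>?N. \<forall>Y'\<in>?N. Y \<noteq> Y' \<longrightarrow> consec n F X Y \<inter> consec n F X Y' = {}"
      using consec_unique_upper[of _ n F X] pairs by blast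
  qed (use fN in auto)
  then have S: "\<delta> * card (through n X) \<le> card S" using up_degree X by auto
  have S_sub: "S \<subseteq> through n X"
    unfolding S_def by (intro UN_least consec_subset)
  have CF: "Z \<subseteq> {1..n}" if "Z \<in> C" for Z using that C(2) subset_ground by auto
  have fK: "finite K"
    unfolding K_def using C finite_member by (auto simp: I_def)
  have KIT: "K \<subseteq> I \<times> T"
    using x CF ltn by (fastforce simp: K_def I_def T_def)
  have "card K \<le> (\<Sum>Z\<in>C - {X}. card ((I \<inter> {card X<..card X + D}) \<times> {x Z})) +
      (\<Sum>Z\<in>{Z \<in> C. X \<subset> Z}. card ({card X + 1} \<times> (Z - X)))"
    unfolding K_def using C(1)
    by (intro order_trans[OF card_Un_le] add_mono card_UN_le) auto
  also have "\<dots> \<le> (\<Sum>Z\<in>C - {X}. D) + (\<Sum>Z\<in>{Z \<in> C. X \<subset> Z}. D)"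
  proof (intro add_mono sum_mono)
    fix Z
    have "card (I \<inter> {card X<..card X + D}) \<le> card {card X<..card X + D}" by (rule card_mono) auto
    then show "card ((I \<inter> {card X<..card X + D}) \<times> {x Z}) \<le> D"
      by (simp add: card_cartesian_product)
    show "card ({card X + 1} \<times> (Z - X)) \<le> D" if "Z \<in> {Z \<in> C. X \<subset> Z}"
      using that card_Diff_le[OF XF, of Z] C(2) by (auto simp: card_cartesian_product)
  qed
  also have "\<dots> \<le> card C * D + card C * D"
    using C(1) by (auto intro!: add_mono mult_right_mono card_mono)
  finally have "real (card K) \<le> 2 * D * card C"
    by (smt (verit, best) mult.commute mult_2 of_nat_mono of_nat_add of_nat_mult distrib_right of_nat_numeral mult.assoc)
  then have cK: "real (card K) \<le> \<delta> * n / 8" using small by simp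
  have "\<delta> * card T \<le> card K + card V"
  proof (rule card_hits_ge[where X = X and S = S and I = I and n = n and j = "card X + 1"])
    fix p assume "p \<in> S"
    then obtain Y where p: "p \<in> consec n F X Y" and XY: "(X, Y) \<in> H" by (auto simp: S_def)
    then have Y: "Y \<in> F" "X \<subset> Y" using pairs by auto
    have pX: "p \<in> through n X" and pY: "p ` {1..card Y} = Y"
      using p by (auto simp: consec_def through_def)
    have lt: "card X < card Y" using Y finite_member psubset_card_mono by blast
    have "p (card X + 1) \<in> p ` {1..card Y}" using lt by (intro imageI) simp
    then have first: "p (card X + 1) \<in> Y - X"
      using through_above[OF pX, of "card X + 1"] ltn pY by simp
    show "(\<exists>(i, x)\<in>K. p i = x) \<or> p (card X + 1) \<in> V"
    proof (cases "good Y")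
      case True
      then show ?thesis using first subset_ground[OF Y(1)] by (auto simp: V_def T_def)
    next
      case False
      then obtain Z where Z: "Z \<in> C" "Z \<noteq> X" "Z \<subseteq> Y \<or> Y \<subseteq> Z" using XY by (auto simp: good_def)
      from Z(3) show ?thesis
      proof
        assume "Z \<subseteq> Y"
        then have "x Z \<in> p ` {1..card Y}" using x[OF Z(1,2)] pY by auto
        then obtain i where i: "i \<in> {1..card Y}" "p i = x Z" by auto
        have "card X < i" using through_below[OF pX, of i] i x[OF Z(1,2)] by fastforce
        moreover have "card Y \<le> card X + D" using spread XF Y by auto
        moreover have "card Y \<le> n" using card_mono[OF _ subset_ground[OF Y(1)]] by simp
        ultimately have "(i, x Z) \<in> K" using Z i by (auto simp: K_def I_def)
        then show ?thesis using i by auto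
      next
        assume "Y \<subseteq> Z"
        then have "(card X + 1, p (card X + 1)) \<in> K"
          unfolding K_def using first Z(1) Y(2) by (intro UnI2 UN_I[of Z]) auto
        then show ?thesis by auto
      qed
    qed
  qed (use XF ltn S S_sub subset_ground through_above fK KIT in
      \<open>auto simp: T_def I_def V_def\<close>)
  \<comment> \<open>The left side of the union bound is at least \<open>\<delta> * n / 4\<close>,
    and \<open>K\<close> accounts for at most \<open>\<delta> * n / 8\<close> of it, so
    \<open>V\<close> is nonempty.\<close>
  moreover have "real n \<le> 4 * card T"
    using size_le[OF XF] subset_ground[OF XF] finite_member[OF XF]
    by (simp add: T_def card_Diff_subset)
  then have "\<delta> * n \<le> 4 * (\<delta> * card T)" using delta_pos by (simp add: mult_left_mono)
  moreover have "0 < \<delta> * n" using delta_pos n_pos by simp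
  ultimately have "0 < card V" using cK by linarith
  then have "V \<noteq> {}" by auto
  then show ?thesis by (auto simp: V_def good_def)
qed

text \<open>Dual to \<open>extend_up\<close>, reading the chain downwards from its last entry
  \<open>p (card X)\<close> in \<open>X\<close>, which the lower neighbour omits. Here the number of
  possible values of that entry is kept, at least
  \<open>\<delta> * n / 4 - \<delta> * n / 8\<close>, since the later pigeonhole argument needs many
  omitted points.\<close>

lemma extend_down_many:
  assumes C: "finite C" "C \<subseteq> F" and X: "X \<in> Range H"
    and max: "\<And>Z. Z \<in> C \<Longrightarrow> X \<subseteq> Z \<Longrightarrow> Z = X"
    and small: "16 * real D * card C \<le> \<delta> * n"
  shows "\<delta> * n \<le> 8 * card {y \<in> X. \<exists>Y. (Y, X) \<in> H \<and> (\<forall>Z\<in>C - {X}. \<not> Z \<subseteq> Y \<and> \<not> Y \<subseteq> Z) \<and> y \<notin> Y}"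
proof -
  define good where "good Y \<longleftrightarrow> (Y, X) \<in> H \<and> (\<forall>Z\<in>C - {X}. \<not> Z \<subseteq> Y \<and> \<not> Y \<subseteq> Z)" for Y
  define I where "I = {1..card X}"
  define x where "x Z = (SOME x. x \<in> X - Z)" for Z
  have XF: "X \<in> F" and pos: "0 < card X"
  proof -
    obtain Y where "(Y, X) \<in> H" using X by auto
    then have Y: "X \<in> F" "Y \<in> F" "Y \<subset> X" using pairs by auto
    then show "X \<in> F" by simp
    have "card Y < card X" using Y finite_member psubset_card_mono by blast
    then show "0 < card X" by simp
  qed
  have x: "x Z \<in> X - Z" if "Z \<in> C" "Z \<noteq> X" for Z
  proof -
    have "\<exists>x. x \<in> X - Z" using max[OF that(1)] that(2) by blast
    then show ?thesis unfolding x_def by (rule someI_ex)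
  qed
  \<comment> \<open>If \<open>Y \<subseteq> Z\<close>, the witness \<open>x Z\<close> of
    \<open>\<not> X \<subseteq> Z\<close> lies outside \<open>Y\<close>, hence among the last
    \<open>D\<close> entries from \<open>X\<close>. If \<open>Z \<subseteq> Y\<close>, the very last
    entry lies outside \<open>Z\<close>.\<close>
  define K where "K = (\<Union>Z\<in>C - {X}. (I \<inter> {card X - D<..card X}) \<times> {x Z}) \<union>
    (\<Union>Z\<in>{Z \<in> C. Z \<subset> X}. {card X} \<times> (X - Z))"
  define V where "V = {y \<in> X. \<exists>Y. good Y \<and> y \<notin> Y}"
  let ?N = "{Y. (Y, X) \<in> H}"
  define S where "S = (\<Union>Y\<in>?N. consec n F Y X)"
  have fN: "finite ?N" by (rule finite_subset[OF _ finite_F]) (use pairs in auto)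
  have "card S = (\<Sum>Y\<in>?N. card (consec n F Y X))" unfolding S_def
  proof (rule card_UN_disjoint)
    show "\<forall>Y\<in>?N. \<forall>Y'\<in>?N. Y \<noteq> Y' \<longrightarrow> consec n F Y X \<inter> consec n F Y' X = {}"
      using consec_unique_lower[of _ n F _ X] pairs by blast
  qed (use fN in auto)
  then have S: "\<delta> * card (through n X) \<le> card S" using down_degree X by auto
  have S_sub: "S \<subseteq> through n X"
    unfolding S_def by (intro UN_least consec_subset)
  have fX: "finite X" using XF by (rule finite_member)
  have fK: "finite K"
    unfolding K_def using C fX by auto
  have KIT: "K \<subseteq> I \<times> X"
    using x pos by (fastforce simp: K_def I_def)
  have "card K \<le> (\<Sum>Z\<in>C - {X}. card ((I \<inter> {card X - D<..card X}) \<times> {x Z})) +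
      (\<Sum>Z\<in>{Z \<in> C. Z \<subset> X}. card ({card X} \<times> (X - Z)))"
    unfolding K_def using C(1)
    by (intro order_trans[OF card_Un_le] add_mono card_UN_le) auto
  also have "\<dots> \<le> (\<Sum>Z\<in>C - {X}. D) + (\<Sum>Z\<in>{Z \<in> C. Z \<subset> X}. D)"
  proof (intro add_mono sum_mono)
    fix Z
    have "card (I \<inter> {card X - D<..card X}) \<le> card {card X - D<..card X}" by (rule card_mono) auto
    then show "card ((I \<inter> {card X - D<..card X}) \<times> {x Z}) \<le> D"
      by (simp add: card_cartesian_product)
    show "card ({card X} \<times> (X - Z)) \<le> D" if "Z \<in> {Z \<in> C. Z \<subset> X}"
      using that card_Diff_le[OF _ XF, of Z] C(2) by (auto simp: card_cartesian_product)
  qed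
  also have "\<dots> \<le> card C * D + card C * D"
    using C(1) by (auto intro!: add_mono mult_right_mono card_mono)
  finally have "real (card K) \<le> 2 * D * card C"
    by (smt (verit, best) mult.commute mult_2 of_nat_mono of_nat_add of_nat_mult distrib_right of_nat_numeral mult.assoc)
  then have cK: "real (card K) \<le> \<delta> * n / 8" using small by simp
  have "\<delta> * card X \<le> card K + card V"
  proof (rule card_hits_ge[where X = X and S = S and I = I and n = n and j = "card X"])
    fix p assume "p \<in> S"
    then obtain Y where p: "p \<in> consec n F Y X" and XY: "(Y, X) \<in> H" by (auto simp: S_def)
    then have Y: "Y \<in> F" "Y \<subset> X" using pairs by auto
    have pX: "p ` {1..card X} = X" and pY: "p \<in> through n Y"
      using p by (auto simp: consec_def through_def)
    have lt: "card Y < card X" using Y fX psubset_card_mono by blast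
    have "card X \<le> n" using card_mono[OF _ subset_ground[OF XF]] by simp
    moreover have "p (card X) \<in> X"
      using through_below[of p n X "card X"] p pos by (simp add: consec_def)
    ultimately have last: "p (card X) \<in> X - Y"
      using through_above[OF pY, of "card X"] pX lt by simp
    show "(\<exists>(i, x)\<in>K. p i = x) \<or> p (card X) \<in> V"
    proof (cases "good Y")
      case True
      then show ?thesis using last by (auto simp: V_def)
    next
      case False
      then obtain Z where Z: "Z \<in> C" "Z \<noteq> X" "Z \<subseteq> Y \<or> Y \<subseteq> Z" using XY by (auto simp: good_def)
      from Z(3) show ?thesis
      proof
        assume "Y \<subseteq> Z"
        then have xZ: "x Z \<in> p ` {1..card X}" "x Z \<notin> Y" using x[OF Z(1,2)] pX by auto
        then obtain i where i: "i \<in> {1..card X}" "p i = x Z" by auto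
        have "card Y < i" using through_below[OF pY, of i] i xZ by fastforce
        moreover have "card X \<le> card Y + D" using spread XF Y by auto
        ultimately have "(i, x Z) \<in> K" using Z i by (auto simp: K_def I_def)
        then show ?thesis using i by auto
      next
        assume "Z \<subseteq> Y"
        then have "(card X, p (card X)) \<in> K"
          unfolding K_def using last Z(1) Y(2) by (intro UnI2 UN_I[of Z]) auto
        then show ?thesis by auto
      qed
    qed
  qed (use XF pos S S_sub subset_ground through_below fK KIT in
      \<open>auto simp: I_def V_def\<close>)
  moreover have "real n \<le> 4 * card X"
    using of_nat_mono[OF size_ge[OF XF], where 'a = real] by simp
  then have "\<delta> * n \<le> 4 * (\<delta> * card X)"
    using mult_left_mono[of "real n" "4 * card X" \<delta>] delta_pos by simp
  ultimately have "\<delta> * n \<le> 8 * card V" using cK by linarith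
  then show ?thesis by (simp add: V_def good_def conj_assoc)
qed

lemma extend_down:
  assumes C: "finite C" "C \<subseteq> F" and X: "X \<in> Range H"
    and max: "\<And>Z. Z \<in> C \<Longrightarrow> X \<subseteq> Z \<Longrightarrow> Z = X"
    and small: "16 * real D * card C \<le> \<delta> * n"
  shows "\<exists>Y. (Y, X) \<in> H \<and> (\<forall>Z\<in>C - {X}. \<not> Z \<subseteq> Y \<and> \<not> Y \<subseteq> Z)"
proof -
  have "0 < \<delta> * n" using delta_pos n_pos by simp
  then have "{y \<in> X. \<exists>Y. (Y, X) \<in> H \<and> (\<forall>Z\<in>C - {X}. \<not> Z \<subseteq> Y \<and> \<not> Y \<subseteq> Z) \<and> y \<notin> Y} \<noteq> {}"
    using extend_down_many[OF assms] by (intro notI) simp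
  then show ?thesis by auto
qed

section \<open>Embedding trees as induced subposets\<close>

text \<open>Nodes are numbered so that parents come first, and \<open>up\<close> alternates along
  edges. Each new node is a leaf, placed by extending from the image of its parent while avoiding
  all sets placed so far. Membership in \<open>Range H\<close> or \<open>Domain H\<close> is what
  allows a node to be extended again.\<close>

lemma embed_tree:
  fixes up :: "nat \<Rightarrow> bool" and par :: "nat \<Rightarrow> nat"
  assumes par: "\<And>i. 0 < i \<Longrightarrow> par i < i" and up: "\<And>i. 0 < i \<Longrightarrow> up (par i) \<noteq> up i"
    and small: "16 * real D * real (N + 1) \<le> \<delta> * real n"
  shows "\<exists>g. (\<forall>i\<le>N. g i \<in> (if up i then Range H else Domain H)) \<and>
    (\<forall>i\<le>N. \<forall>j\<le>N. g i \<subseteq> g j \<longleftrightarrow> i = j \<or> \<not> up i \<and> up j \<and> (0 < i \<and> par i = j \<or> 0 < j \<and> par j = i))"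
  using small
proof (induction N rule: nat_induct)
  case 0
  obtain X Y where "(X, Y) \<in> H" using nonempty by auto
  then show ?case by (intro exI[of _ "\<lambda>_. if up 0 then Y else X"]) auto
next
  case (Suc N)
  have "16 * real D * (N + 1) \<le> 16 * real D * (Suc N + 1)" by (intro mult_left_mono) auto
  then have sm: "16 * real D * (N + 1) \<le> \<delta> * n" using Suc.prems by linarith
  obtain g where g': "\<forall>i\<le>N. g i \<in> (if up i then Range H else Domain H)"
    and rel': "\<forall>i\<le>N. \<forall>j\<le>N. g i \<subseteq> g j \<longleftrightarrow>
      i = j \<or> \<not> up i \<and> up j \<and> (0 < i \<and> par i = j \<or> 0 < j \<and> par j = i)"
    using Suc.IH[OF sm] by (elim exE conjE)
  note g = g'[rule_format] and rel = rel'[rule_format]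
  define q where "q = par (Suc N)"
  have q: "q \<le> N" "up (Suc N) \<noteq> up q" using par[of "Suc N"] up[of "Suc N"] by (auto simp: q_def)
  let ?C = "g ` {..N}"
  have "g i \<in> F" if "i \<le> N" for i using g[OF that] pairs by (cases "up i") auto
  then have C: "finite ?C" "?C \<subseteq> F" by auto
  have "card ?C \<le> N + 1" using card_image_le[of "{..N}" g] by simp
  then have smC: "16 * real D * card ?C \<le> \<delta> * n"
    using sm mult_left_mono[of "real (card ?C)" "real (N + 1)" "16 * real D"] by linarith
  have inj: "g i = g j \<longleftrightarrow> i = j" if "i \<le> N" "j \<le> N" for i j
  proof
    assume "g i = g j"
    then have "g i \<subseteq> g j" "g j \<subseteq> g i" by simp_all
    then show "i = j" using rel[OF that] rel[OF that(2,1)] by metis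
  qed simp
  have par_ne: "par i \<noteq> Suc N" if "0 < i" "i \<le> N" for i using par[of i] that by auto
  have "\<exists>Z. Z \<in> (if up (Suc N) then Range H else Domain H) \<and>
      (\<forall>i\<le>N. (g i \<subseteq> Z \<longleftrightarrow> \<not> up i \<and> up (Suc N) \<and> q = i) \<and>
             (Z \<subseteq> g i \<longleftrightarrow> \<not> up (Suc N) \<and> up i \<and> q = i))"
  proof (cases "up q")
    case True
    \<comment> \<open>Inclusions between distinct placed sets run only from lower to upper nodes, so
      the upper set \<open>g q\<close> is maximal among them, as \<open>extend_down\<close>
      demands.\<close>
    have "\<exists>Z. (Z, g q) \<in> H \<and> (\<forall>Y\<in>?C - {g q}. \<not> Y \<subseteq> Z \<and> \<not> Z \<subseteq> Y)"
      by (rule extend_down[OF C _ _ smC]) (use g[OF q(1)] True rel q in auto)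
    then obtain Z where Z1: "(Z, g q) \<in> H" and Z2: "\<forall>Y\<in>?C - {g q}. \<not> Y \<subseteq> Z \<and> \<not> Z \<subseteq> Y" by blast
    have Z3: "\<not> g i \<subseteq> Z \<and> \<not> Z \<subseteq> g i" if "i \<le> N" "i \<noteq> q" for i
      using bspec[OF Z2, of "g i"] inj[OF that(1) q(1)] that by simp
    have "Z \<subset> g q" using pairs[OF Z1] by simp
    then have "(g i \<subseteq> Z \<longleftrightarrow> False) \<and> (Z \<subseteq> g i \<longleftrightarrow> q = i)" if "i \<le> N" for i
      using Z3[OF that] by (cases "i = q") auto
    then show ?thesis using Z1 q(2) True by (intro exI[of _ Z]) auto
  next
    case False
    have "\<exists>Z. (g q, Z) \<in> H \<and> (\<forall>Y\<in>?C - {g q}. \<not> Y \<subseteq> Z \<and> \<not> Z \<subseteq> Y)"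
      by (rule extend_up[OF C _ _ smC]) (use g[OF q(1)] False rel q in auto)
    then obtain Z where Z1: "(g q, Z) \<in> H" and Z2: "\<forall>Y\<in>?C - {g q}. \<not> Y \<subseteq> Z \<and> \<not> Z \<subseteq> Y" by blast
    have Z3: "\<not> g i \<subseteq> Z \<and> \<not> Z \<subseteq> g i" if "i \<le> N" "i \<noteq> q" for i
      using bspec[OF Z2, of "g i"] inj[OF that(1) q(1)] that by simp
    have "g q \<subset> Z" using pairs[OF Z1] by simp
    then have "(g i \<subseteq> Z \<longleftrightarrow> q = i) \<and> (Z \<subseteq> g i \<longleftrightarrow> False)" if "i \<le> N" for i
      using Z3[OF that] by (cases "i = q") auto
    then show ?thesis using Z1 q(2) False by (intro exI[of _ Z]) auto
  qed
  then obtain Z where Z: "Z \<in> (if up (Suc N) then Range H else Domain H)"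
    and Z': "\<forall>i\<le>N. (g i \<subseteq> Z \<longleftrightarrow> \<not> up i \<and> up (Suc N) \<and> q = i) \<and>
             (Z \<subseteq> g i \<longleftrightarrow> \<not> up (Suc N) \<and> up i \<and> q = i)"
    by (elim exE conjE)
  note Zrel = Z'[rule_format, THEN conjunct1] Z'[rule_format, THEN conjunct2]
  show ?case
  proof (intro exI[of _ "g(Suc N := Z)"] conjI allI impI)
    fix i assume "i \<le> Suc N"
    then show "(g(Suc N := Z)) i \<in> (if up i then Range H else Domain H)"
      using g[of i] Z by (cases "i = Suc N") auto
  next
    fix i j assume ij: "i \<le> Suc N" "j \<le> Suc N"
    consider "i = Suc N" "j = Suc N" | "i = Suc N" "j \<le> N" | "i \<le> N" "j = Suc N" | "i \<le> N" "j \<le> N"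
      using ij by linarith
    then show "(g(Suc N := Z)) i \<subseteq> (g(Suc N := Z)) j \<longleftrightarrow>
      i = j \<or> \<not> up i \<and> up j \<and> (0 < i \<and> par i = j \<or> 0 < j \<and> par j = i)"
    proof cases
      case 2
      then show ?thesis using Zrel(2)[of j] par_ne[of j] by (auto simp: q_def)
    next
      case 3
      then show ?thesis using Zrel(1)[of i] par_ne[of i] by (auto simp: q_def)
    next
      case 4
      then show ?thesis using rel[of i j] by simp
    qed simp
  qed
qed

end

section \<open>Spiders and the paths along two legs\<close>

text \<open>The spider has centre \<open>0\<close> and legs of length \<open>L\<close>; the node at distance \<open>d > 0\<close> from the centre on
  leg \<open>l\<close> is \<open>l * L + d\<close>. The path \<open>spider_path L s t\<close> is indexed by \<open>1..2 * L + 1\<close>, from the end of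
  leg \<open>s\<close> to the end of leg \<open>t\<close>.\<close>

definition spider_depth :: "nat \<Rightarrow> nat \<Rightarrow> nat" where
  "spider_depth L x = (if x = 0 then 0 else Suc ((x - 1) mod L))"

text \<open>The formula describes a spider with infinitely many legs; the nodes up to
  \<open>m * L\<close> form its first \<open>m\<close> legs.\<close>

definition spider_parent :: "nat \<Rightarrow> nat \<Rightarrow> nat" where
  "spider_parent L x = (if (x - 1) mod L = 0 then 0 else x - 1)"

definition spider_node :: "nat \<Rightarrow> nat \<Rightarrow> nat \<Rightarrow> nat" where
  "spider_node L l d = (if d = 0 then 0 else l * L + d)"

lemma spider_depth_node:
  assumes "d \<le> L" shows "spider_depth L (spider_node L l d) = d"
proof (cases d)
  case (Suc e)
  then have "(l * L + e) mod L = e" using assms by simp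
  then show ?thesis using Suc by (simp add: spider_depth_def spider_node_def)
qed (simp add: spider_depth_def spider_node_def)

lemma spider_parent_node:
  assumes "0 < d" "d \<le> L" shows "spider_parent L (spider_node L l d) = spider_node L l (d - 1)"
proof (cases d)
  case (Suc e)
  then have "(l * L + e) mod L = e" using assms by simp
  then show ?thesis using Suc by (simp add: spider_parent_def spider_node_def)
qed (use assms in simp)

lemma spider_node_eq_iff:
  assumes "d \<le> L" "d' \<le> L"
  shows "spider_node L l d = spider_node L l' d' \<longleftrightarrow> d = d' \<and> (d = 0 \<or> l = l')"
proof
  assume eq: "spider_node L l d = spider_node L l' d'"
  then have "d = d'" using spider_depth_node assms by metis
  then show "d = d' \<and> (d = 0 \<or> l = l')" using eq assms by (cases "L = 0") (auto simp: spider_node_def split: if_splits)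
qed (auto simp: spider_node_def)

lemma spider_node_le:
  assumes "l < m" "d \<le> L" shows "spider_node L l d \<le> m * L"
proof -
  have "(l + 1) * L \<le> m * L" using assms by (intro mult_right_mono) auto
  then show ?thesis using assms by (simp add: spider_node_def)
qed

lemma spider_parent_less: "0 < x \<Longrightarrow> spider_parent L x < x"
  by (simp add: spider_parent_def)

lemma spider_depth_parent:
  assumes "0 < x" shows "spider_depth L x = Suc (spider_depth L (spider_parent L x))"
proof (cases "(x - 1) mod L = 0")
  case True
  then show ?thesis using assms by (simp add: spider_depth_def spider_parent_def)
next
  case False
  then have "x - 1 \<noteq> 0" by (metis mod_0)
  then obtain y where y: "x = Suc (Suc y)" by (metis One_nat_def Suc_pred assms diff_Suc_1 not0_implies_Suc)
  then show ?thesis using False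
    by (auto simp: spider_depth_def spider_parent_def mod_Suc split: if_splits)
qed

definition spider_path :: "nat \<Rightarrow> nat \<Rightarrow> nat \<Rightarrow> nat \<Rightarrow> nat" where
  "spider_path L s t r = (if r \<le> L + 1 then spider_node L s (L + 1 - r) else spider_node L t (r - (L + 1)))"

text \<open>These are the facts that turn the induced order on the spider into a zigzag: no
  repetition, upper nodes at exactly the odd positions, and tree edges exactly between neighbouring
  positions. The centre is at position \<open>L + 1\<close>.\<close>

lemma spider_path_props:
  assumes L: "0 < L" and st: "s \<noteq> t" and r: "r \<in> {1..2 * L + 1}" "r' \<in> {1..2 * L + 1}"
  shows "spider_path L s t r = spider_path L s t r' \<longleftrightarrow> r = r'"
    and "even (L - spider_depth L (spider_path L s t r)) \<longleftrightarrow> odd r"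
    and "0 < spider_path L s t r \<and> spider_parent L (spider_path L s t r) = spider_path L s t r' \<or>
      0 < spider_path L s t r' \<and> spider_parent L (spider_path L s t r') = spider_path L s t r \<longleftrightarrow>
      r' = r + 1 \<or> r = r' + 1"
proof -
  define l where "l r = (if r \<le> L + 1 then s else t)" for r
  define d where "d r = (if r \<le> L + 1 then L + 1 - r else r - (L + 1))" for r
  have path: "spider_path L s t r = spider_node L (l r) (d r)" for r
    by (simp add: spider_path_def l_def d_def)
  have d: "d r \<le> L" "d r' \<le> L" using r by (auto simp: d_def)
  show "spider_path L s t r = spider_path L s t r' \<longleftrightarrow> r = r'"
    using d r st unfolding path by (subst spider_node_eq_iff) (auto simp: d_def l_def split: if_splits)
  have "even (L - d r) \<longleftrightarrow> odd r"
  proof (cases "r \<le> L + 1")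
    case True
    then have "L - d r = r - 1" using r by (simp add: d_def)
    then show ?thesis using r by (cases r) auto
  next
    case False
    then have "L - d r + r = 2 * L + 1" using r by (simp add: d_def)
    then show ?thesis by (metis even_add odd_two_times_div_two_succ dvd_triv_left odd_one)
  qed
  then show "even (L - spider_depth L (spider_path L s t r)) \<longleftrightarrow> odd r"
    unfolding path using d by (simp add: spider_depth_node)
  \<comment> \<open>The parent relation in coordinates of leg and depth; the leg is irrelevant when
    the parent is the centre.\<close>
  have par: "0 < spider_node L (l a) (d a) \<and> spider_parent L (spider_node L (l a) (d a)) = spider_node L (l b) (d b)
      \<longleftrightarrow> d a = d b + 1 \<and> (d b = 0 \<or> l a = l b)" if "d a \<le> L" "d b \<le> L" for a b
  proof (cases "d a = 0")
    case False
    then have "0 < spider_node L (l a) (d a)" by (simp add: spider_node_def)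
    moreover have "d a - 1 \<le> L" using that by simp
    ultimately show ?thesis using False that
      by (simp add: spider_parent_node spider_node_eq_iff) auto
  qed (simp add: spider_node_def)
  show "0 < spider_path L s t r \<and> spider_parent L (spider_path L s t r) = spider_path L s t r' \<or>
      0 < spider_path L s t r' \<and> spider_parent L (spider_path L s t r') = spider_path L s t r \<longleftrightarrow>
      r' = r + 1 \<or> r = r' + 1"
    unfolding path par[OF d] par[OF d(2,1)] using r st by (auto simp: d_def l_def split: if_splits)
qed

section \<open>Completing a zigzag, and a pigeonhole principle\<close>

text \<open>Both ends of the given zigzag are upper sets because \<open>M\<close> is odd; the new
  lower sets \<open>X\<close> and \<open>Y\<close> take the even positions \<open>0\<close> and
  \<open>M + 1\<close>.\<close>

lemma zigzag_add_ends:
  fixes Q :: "nat \<Rightarrow> 'a set"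
  assumes M: "odd M"
    and Q: "\<And>r r'. r \<in> {1..M} \<Longrightarrow> r' \<in> {1..M} \<Longrightarrow>
      Q r \<subseteq> Q r' \<longleftrightarrow> r = r' \<or> even r \<and> odd r' \<and> (r' = r + 1 \<or> r = r' + 1)"
    and X: "\<And>r. r \<in> {1..M} \<Longrightarrow> (X \<subseteq> Q r \<longleftrightarrow> r = 1) \<and> \<not> Q r \<subseteq> X"
    and Y: "\<And>r. r \<in> {1..M} \<Longrightarrow> (Y \<subseteq> Q r \<longleftrightarrow> r = M) \<and> \<not> Q r \<subseteq> Y"
    and XY: "\<not> X \<subseteq> Y" "\<not> Y \<subseteq> X"
  defines "P \<equiv> \<lambda>r. if r = 0 then X else if r \<le> M then Q r else Y"
  shows "\<forall>r\<le>M + 1. \<forall>r'\<le>M + 1.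
    P r \<subseteq> P r' \<longleftrightarrow> r = r' \<or> even r \<and> odd r' \<and> (r' = r + 1 \<or> r = r' + 1)"
proof (intro allI impI)
  fix r r' assume le: "r \<le> M + 1" "r' \<le> M + 1"
  have Pm: "P r = Q r" if "r \<in> {1..M}" for r
    using that by (simp_all add: P_def)
  have pos: "0 < M" using M by (rule odd_pos)
  have cases: "r = 0 \<or> r \<in> {1..M} \<or> r = M + 1" if "r \<le> M + 1" for r
    using that by auto
  consider "r = 0" "r' = 0" | "r = 0" "r' \<in> {1..M}" | "r = 0" "r' = M + 1"
    | "r \<in> {1..M}" "r' = 0" | "r \<in> {1..M}" "r' \<in> {1..M}" | "r \<in> {1..M}" "r' = M + 1"
    | "r = M + 1" "r' = 0" | "r = M + 1" "r' \<in> {1..M}" | "r = M + 1" "r' = M + 1"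
    using cases[OF le(1)] cases[OF le(2)] by argo
  then show "P r \<subseteq> P r' \<longleftrightarrow> r = r' \<or> even r \<and> odd r' \<and> (r' = r + 1 \<or> r = r' + 1)"
  proof cases
    case 2 then show ?thesis using X[of r'] Pm[of r'] by (auto simp: P_def)
  next
    case 3 then show ?thesis using XY pos M by (auto simp: P_def)
  next
    case 4 then show ?thesis using X[of r] Pm[of r] by (auto simp: P_def)
  next
    case 5 then show ?thesis using Q[of r r'] Pm[of r] Pm[of r'] by simp
  next
    case 6 then show ?thesis using Y[of r] Pm[of r] M by (auto simp: P_def)
  next
    case 7 then show ?thesis using XY pos M by (auto simp: P_def)
  next
    case 8 then show ?thesis using Y[of r'] Pm[of r'] M by (auto simp: P_def)
  qed simp_all
qed

lemma pigeonhole_disjoint: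
  fixes W :: "nat \<Rightarrow> 'a set" and c :: real and m :: nat
  assumes "finite S" "\<And>j. j < m \<Longrightarrow> W j \<subseteq> S" "\<And>j. j < m \<Longrightarrow> c \<le> card (W j)" "card S < m * c"
  obtains s t where "s < m" "t < m" "s \<noteq> t" "W s \<inter> W t \<noteq> {}"
proof (rule ccontr)
  assume "\<not> thesis"
  then have disj: "\<forall>s\<in>{..<m}. \<forall>t\<in>{..<m}. s \<noteq> t \<longrightarrow> W s \<inter> W t = {}" using that by auto
  have fin: "\<forall>j\<in>{..<m}. finite (W j)" using assms(1,2) finite_subset by blast
  have "card (\<Union>j<m. W j) = (\<Sum>j<m. card (W j))" using disj fin by (intro card_UN_disjoint) auto
  then have "(\<Sum>j<m. real (card (W j))) = card (\<Union>j<m. W j)" by simp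
  also have "\<dots> \<le> card S" using assms(1,2) by (intro of_nat_mono card_mono) auto
  finally have "(\<Sum>j<m. real (card (W j))) \<le> card S" .
  moreover have "(\<Sum>j<m. c) \<le> (\<Sum>j<m. real (card (W j)))" using assms(3) by (intro sum_mono) auto
  ultimately show False using assms(4) by simp
qed

section \<open>Zigzags with a common point\<close>

context dense_pairs
begin

text \<open>The size of a set difference obeys a triangle inequality. Each tree edge costs at most
  \<open>D\<close>, and a node reaches the root in at most \<open>N\<close> steps, so going through
  the root costs at most \<open>2 * N * D\<close>.\<close>

lemma card_Diff_nodes_le:
  assumes par: "\<And>i. 0 < i \<Longrightarrow> par i < i"
    and gF: "\<And>i. i \<le> N \<Longrightarrow> g i \<in> F"
    and adj: "\<And>i. 0 < i \<Longrightarrow> i \<le> N \<Longrightarrow> g i \<subseteq> g (par i) \<or> g (par i) \<subseteq> g i"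
    and i: "i \<le> N" and j: "j \<le> N"
  shows "card (g i - g j) \<le> 2 * N * D"
proof -
  have tri: "card (X - Z) \<le> card (X - Y) + card (Y - Z)" if "X \<in> F" "Y \<in> F" for X Y Z
  proof -
    have "card (X - Z) \<le> card ((X - Y) \<union> (Y - Z))"
      using that finite_member by (intro card_mono) auto
    then show ?thesis using card_Un_le le_trans by blast
  qed
  have step: "card (g i - g (par i)) \<le> D \<and> card (g (par i) - g i) \<le> D" if "0 < i" "i \<le> N" for i
  proof -
    have "par i \<le> N" using par[OF that(1)] that(2) by simp
    then show ?thesis
      using adj[OF that] card_Diff_le[of "g i" "g (par i)"] card_Diff_le[of "g (par i)" "g i"] gF that
      by (auto simp: Diff_eq_empty_iff[THEN iffD2])
  qed
  have root: "card (g i - g 0) \<le> i * D \<and> card (g 0 - g i) \<le> i * D" if "i \<le> N" for i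
    using that
  proof (induction i rule: less_induct)
    case (less i)
    show ?case
    proof (cases "i = 0")
      case False
      then have q: "par i < i" "par i \<le> N" using par[of i] less.prems by auto
      have "par i * D + D \<le> i * D"
        using mult_right_mono[of "par i + 1" i D] q(1) by simp
      moreover note less.IH[OF q] step[of i] tri[of "g i" "g (par i)" "g 0"] tri[of "g 0" "g (par i)" "g i"]
      ultimately show ?thesis using gF[OF less.prems] gF[OF q(2)] gF[of 0] False less.prems by fastforce
    qed simp
  qed
  have "card (g i - g j) \<le> card (g i - g 0) + card (g 0 - g j)" using tri gF i by simp
  also have "\<dots> \<le> N * D + N * D"
    using root[OF i] root[OF j] i j by (meson add_mono le_trans mult_le_mono1)
  finally show ?thesis by simp
qed

text \<open>Each of \<open>m\<close> leaves has at least \<open>\<delta> * n / 16\<close> usable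
  points \<open>y\<close>, and \<open>16 < m * \<delta>\<close> makes their total exceed
  \<open>n\<close>, so two legs share one. The path along these legs, with one further lower set
  omitting \<open>y\<close> at each end, is the zigzag.\<close>

lemma ex_zigzag:
  fixes m L :: nat
  assumes L: "0 < L" and m: "16 < m * \<delta>"
    and small: "32 * real (m * L + 1) * real (m * L + 1) * D \<le> \<delta> * n"
  shows "\<exists>P y. (\<forall>r\<le>2 * L + 2. P r \<in> F) \<and>
    (\<forall>r\<le>2 * L + 2. \<forall>r'\<le>2 * L + 2.
      P r \<subseteq> P r' \<longleftrightarrow> r = r' \<or> even r \<and> odd r' \<and> (r' = r + 1 \<or> r = r' + 1)) \<and>
    y \<notin> P 0 \<and> y \<notin> P (2 * L + 2) \<and> (\<forall>r\<in>{1..2 * L + 1}. y \<in> P r)"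
proof -
  define N where "N = m * L"
  \<comment> \<open>Parity is counted from the leaves, so that leaves are upper whether
    \<open>L\<close> is even or odd.\<close>
  define up where "up i \<longleftrightarrow> even (L - spider_depth L i)" for i
  let ?par = "spider_parent L"
  have upp: "up (?par i) \<noteq> up i" if "0 < i" for i
  proof -
    have "spider_depth L i \<le> L"
      using L mod_less_divisor[OF L, of "i - 1"] by (simp add: spider_depth_def Suc_le_eq)
    then show ?thesis
      unfolding up_def spider_depth_parent[OF that, of L] by (simp add: Suc_diff_Suc[symmetric])
  qed
  have "16 * real D * real (N + 1) \<le> 32 * real (N + 1) * real (N + 1) * D"
    by (simp add: mult_right_mono algebra_simps)
  then have sm: "16 * real D * real (N + 1) \<le> \<delta> * real n" using small by (simp add: N_def)
  have "\<exists>g. (\<forall>i\<le>N. g i \<in> (if up i then Range H else Domain H)) \<and>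
    (\<forall>i\<le>N. \<forall>j\<le>N. g i \<subseteq> g j \<longleftrightarrow>
      i = j \<or> \<not> up i \<and> up j \<and> (0 < i \<and> ?par i = j \<or> 0 < j \<and> ?par j = i))"
    by (rule embed_tree[OF _ _ sm]) (simp_all add: spider_parent_less upp)
  then obtain g where g': "\<forall>i\<le>N. g i \<in> (if up i then Range H else Domain H)"
    and rel': "\<forall>i\<le>N. \<forall>j\<le>N. g i \<subseteq> g j \<longleftrightarrow>
      i = j \<or> \<not> up i \<and> up j \<and> (0 < i \<and> ?par i = j \<or> 0 < j \<and> ?par j = i)"
    by (elim exE conjE)
  note g = g'[rule_format] and rel = rel'[rule_format]
  have gF: "g i \<in> F" if "i \<le> N" for i using g[OF that] pairs by (cases "up i") auto
  have adj: "g i \<subseteq> g (?par i) \<or> g (?par i) \<subseteq> g i" if "0 < i" "i \<le> N" for i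
  proof -
    have "?par i \<le> N" using spider_parent_less[OF that(1), of L] that(2) by simp
    then show ?thesis
      using rel[OF that(2), of "?par i"] rel[of "?par i" i] upp[OF that(1)] that by metis
  qed
  define C where "C = g ` {..N}"
  have C: "finite C" "C \<subseteq> F" using gF by (auto simp: C_def)
  have "card C \<le> N + 1" using card_image_le[of "{..N}" g] by (simp add: C_def)
  then have smC: "16 * real D * card C \<le> \<delta> * n"
    using sm mult_left_mono[of "real (card C)" "real (N + 1)" "16 * real D"] by linarith
  define lf where "lf j = spider_node L j L" for j
  have lfN: "lf j \<le> N" if "j < m" for j using spider_node_le[OF that] by (simp add: lf_def N_def)
  have lfup: "up (lf j)" for j by (simp add: lf_def up_def spider_depth_node)
  \<comment> \<open>\<open>X\<close> can serve as the end of the fence below leaf \<open>j\<close>: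
    it is incomparable to every other set of the spider.\<close>
  define good where "good j X \<longleftrightarrow> (X, g (lf j)) \<in> H \<and>
    (\<forall>Z\<in>C - {g (lf j)}. \<not> Z \<subseteq> X \<and> \<not> X \<subseteq> Z)" for j X
  define V where "V j = {y \<in> g (lf j). \<exists>X. good j X \<and> y \<notin> X}" for j
  define W where "W j = V j \<inter> (\<Inter>i\<le>N. g i)" for j
  have V: "\<delta> * n \<le> 8 * card (V j)" if "j < m" for j
  proof -
    have "g (lf j) \<in> Range H" using g[OF lfN[OF that]] lfup by simp
    moreover have "Z = g (lf j)" if "Z \<in> C" "g (lf j) \<subseteq> Z" for Z
      using that rel[OF lfN[OF \<open>j < m\<close>]] lfup by (auto simp: C_def)
    ultimately have "\<delta> * n \<le> 8 * card {y \<in> g (lf j). \<exists>X. (X, g (lf j)) \<in> H \<and>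
      (\<forall>Z\<in>C - {g (lf j)}. \<not> Z \<subseteq> X \<and> \<not> X \<subseteq> Z) \<and> y \<notin> X}"
      using extend_down_many[OF C, of "g (lf j)"] smC by blast
    then show ?thesis by (simp add: V_def good_def conj_assoc)
  qed
  have W: "\<delta> * n / 16 \<le> card (W j)" if "j < m" for j
  proof -
    have fV: "finite (V j)" using finite_member[OF gF[OF lfN[OF that]]] by (simp add: V_def)
    have fL: "finite (g (lf j))" using finite_member[OF gF[OF lfN[OF that]]] .
    \<comment> \<open>Of the at least \<open>\<delta> * n / 8\<close> points in \<open>V j\<close>,
      those missed by some node number at most \<open>2 * (N + 1) * (N + 1) * D\<close>, which
      \<open>small\<close> bounds by \<open>\<delta> * n / 16\<close>.\<close>
    have "V j \<subseteq> W j \<union> (\<Union>i\<in>{..N}. g (lf j) - g i)" by (auto simp: W_def V_def)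
    then have "card (V j) \<le> card (W j \<union> (\<Union>i\<in>{..N}. g (lf j) - g i))"
      using fV fL by (intro card_mono) (auto simp: W_def)
    also have "\<dots> \<le> card (W j) + card (\<Union>i\<in>{..N}. g (lf j) - g i)" by (rule card_Un_le)
    also have "card (\<Union>i\<in>{..N}. g (lf j) - g i) \<le> (\<Sum>i\<in>{..N}. card (g (lf j) - g i))"
      by (rule card_UN_le) simp
    also have "\<dots> \<le> (\<Sum>i\<in>{..N}. 2 * N * D)"
      using card_Diff_nodes_le[of ?par N g, OF spider_parent_less gF adj lfN[OF that]]
      by (intro sum_mono) auto
    also have "\<dots> \<le> 2 * (N + 1) * (N + 1) * D" by (simp add: algebra_simps)
    finally have "real (card (V j)) \<le> real (card (W j) + 2 * (N + 1) * (N + 1) * D)"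
      by (simp only: of_nat_le_iff)
    then have "16 * real (card (V j)) \<le> 16 * real (card (W j)) + 32 * real (N + 1) * real (N + 1) * D"
      by (simp add: algebra_simps)
    then show ?thesis using V[OF that] small[folded N_def] by linarith
  qed
  have "16 * real n < m * \<delta> * n" using mult_strict_right_mono[OF m, of "real n"] n_pos by simp
  then have "card {1..n} < m * (\<delta> * n / 16)" by simp
  moreover have "W j \<subseteq> {1..n}" if "j < m" for j
    using subset_ground[OF gF[OF lfN[OF that]]] by (auto simp: W_def V_def)
  ultimately obtain s t where st: "s < m" "t < m" "s \<noteq> t" "W s \<inter> W t \<noteq> {}"
    using W pigeonhole_disjoint[of "{1..n}" m W "\<delta> * n / 16"] by blast
  then obtain y where y: "y \<in> W s" "y \<in> W t" by auto
  obtain X where X: "good s X" "y \<notin> X" using y(1) by (auto simp: W_def V_def)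
  obtain Y where Y: "good t Y" "y \<notin> Y" using y(2) by (auto simp: W_def V_def)
  have yg: "y \<in> g i" if "i \<le> N" for i using y(1) that by (auto simp: W_def)
  define M where "M = 2 * L + 1"
  define x where "x = spider_path L s t"
  have xN: "x r \<le> N" if "r \<in> {1..M}" for r
    using that spider_node_le st by (auto simp: x_def spider_path_def N_def M_def)
  have x1: "x 1 = lf s" and xM: "x M = lf t"
    using L by (auto simp: x_def spider_path_def lf_def M_def)
  have xinj: "x r = x r' \<longleftrightarrow> r = r'" if "r \<in> {1..M}" "r' \<in> {1..M}" for r r'
    using spider_path_props(1)[OF L st(3)] that by (simp add: x_def M_def)
  have xup: "up (x r) \<longleftrightarrow> odd r" if "r \<in> {1..M}" for r
    unfolding up_def x_def using that[unfolded M_def] by (intro spider_path_props(2)[OF L st(3)])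
  have xadj: "0 < x r \<and> ?par (x r) = x r' \<or> 0 < x r' \<and> ?par (x r') = x r \<longleftrightarrow> r' = r + 1 \<or> r = r' + 1"
    if "r \<in> {1..M}" "r' \<in> {1..M}" for r r'
    unfolding x_def using that[unfolded M_def] by (intro spider_path_props(3)[OF L st(3)])
  have xrel: "g (x r) \<subseteq> g (x r') \<longleftrightarrow> r = r' \<or> even r \<and> odd r' \<and> (r' = r + 1 \<or> r = r' + 1)"
    if "r \<in> {1..M}" "r' \<in> {1..M}" for r r'
    unfolding rel[OF xN[OF that(1)] xN[OF that(2)]] xinj[OF that] xup[OF that(1)] xup[OF that(2)] xadj[OF that]
    by simp
  have ginj: "g i = g j \<longleftrightarrow> i = j" if "i \<le> N" "j \<le> N" for i j
  proof
    assume "g i = g j"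
    then have "g i \<subseteq> g j" "g j \<subseteq> g i" by simp_all
    then show "i = j" using rel[OF that] rel[OF that(2,1)] by metis
  qed simp
  have M: "1 \<in> {1..M}" "M \<in> {1..M}" "odd M" "1 < M" using L by (auto simp: M_def)
  have XH: "X \<in> F" "X \<subset> g (x 1)" using pairs[of X "g (lf s)"] X(1) unfolding good_def x1 by simp_all
  have YH: "Y \<in> F" "Y \<subset> g (x M)" using pairs[of Y "g (lf t)"] Y(1) unfolding good_def xM by simp_all
  have gne: "g (x r) \<in> C - {g (x r')}" if "r \<in> {1..M}" "r' \<in> {1..M}" "r \<noteq> r'" for r r'
    using ginj[OF xN[OF that(1)] xN[OF that(2)]] xinj[OF that(1,2)] xN[OF that(1)] that(3)
    by (simp add: C_def)
  have Xr: "(X \<subseteq> g (x r) \<longleftrightarrow> r = 1) \<and> \<not> g (x r) \<subseteq> X" if r: "r \<in> {1..M}" for r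
  proof (cases "r = 1")
    case False
    then show ?thesis
      using X(1) gne[OF r M(1)] unfolding good_def x1[symmetric] by simp
  qed (use XH(2) in auto)
  have Yr: "(Y \<subseteq> g (x r) \<longleftrightarrow> r = M) \<and> \<not> g (x r) \<subseteq> Y" if r: "r \<in> {1..M}" for r
  proof (cases "r = M")
    case False
    then show ?thesis
      using Y(1) gne[OF r M(2)] unfolding good_def xM[symmetric] by simp
  qed (use YH(2) in auto)
  \<comment> \<open>\<open>X\<close> and \<open>Y\<close> were chosen independently, but \<open>X\<close> is not even contained in the leaf above \<open>Y\<close>.\<close>
  have XY: "\<not> X \<subseteq> Y" "\<not> Y \<subseteq> X"
    using Xr[OF M(2)] Yr[OF M(1)] XH(2) YH(2) M(4) by auto
  define P where "P r = (if r = 0 then X else if r \<le> M then g (x r) else Y)" for r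
  have "\<forall>r\<le>M + 1. \<forall>r'\<le>M + 1.
      P r \<subseteq> P r' \<longleftrightarrow> r = r' \<or> even r \<and> odd r' \<and> (r' = r + 1 \<or> r = r' + 1)"
    unfolding P_def by (rule zigzag_add_ends[OF M(3) xrel Xr Yr XY])
  moreover have "\<forall>r\<le>M + 1. P r \<in> F"
    using XH(1) YH(1) gF[OF xN] by (simp add: P_def)
  moreover have "\<forall>r\<in>{1..M}. y \<in> P r" using yg[OF xN] by (simp add: P_def)
  moreover have "y \<notin> P 0" "y \<notin> P (M + 1)" using X(2) Y(2) by (simp_all add: P_def)
  moreover have M1: "2 * L + 2 = M + 1" by (simp add: M_def)
  ultimately show ?thesis unfolding M_def[symmetric] M1 by (intro exI[of _ P] exI[of _ y] conjI)
qed

end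

section \<open>From a large family to a dense relation\<close>

text \<open>Consecutive pairs carry at least the proportion
  \<open>\<epsilon> / (1 + \<epsilon>) = 3 * \<delta>\<close> of the total weight \<open>V\<close>
  of the members. Charging \<open>\<delta>\<close> times its weight to each member on either side
  costs at most \<open>2 * \<delta> * V\<close>, so the pruning lemma applies.\<close>

lemma ex_dense_pairs:
  fixes \<epsilon> :: real
  assumes ground: "\<And>X. X \<in> F \<Longrightarrow> X \<subseteq> {1..n}"
    and ge: "\<And>X. X \<in> F \<Longrightarrow> n \<le> 4 * card X"
    and le: "\<And>X. X \<in> F \<Longrightarrow> 4 * card X \<le> 3 * n"
    and spread: "\<And>X Y. X \<in> F \<Longrightarrow> Y \<in> F \<Longrightarrow> card Y \<le> card X + D"
    and card: "(1 + \<epsilon>) * real (n choose (n div 2)) \<le> real (card F)" and eps: "0 < \<epsilon>"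
  shows "\<exists>H. dense_pairs n D (\<epsilon> / (3 * (1 + \<epsilon>))) F H"
proof -
  define \<delta> where "\<delta> = \<epsilon> / (3 * (1 + \<epsilon>))"
  have \<delta>: "0 < \<delta>" using eps by (simp add: \<delta>_def)
  have fF: "finite F" by (rule finite_subset[of _ "Pow {1..n}"]) (use ground in auto)
  define E where "E = {(X, Y). X \<in> F \<and> Y \<in> F \<and> X \<subset> Y}"
  define M where "M = n choose (n div 2)"
  define t where "t X = real (card (through n X))" for X
  define V where "V = sum t F"
  define w where "w z = real (card (consec n F (fst z) (snd z)))" for z
  have fE: "finite E" by (rule finite_subset[of _ "F \<times> F"]) (use fF in \<open>auto simp: E_def\<close>)
  have M: "0 < M" by (simp add: M_def)
  \<comment> \<open>Since the middle binomial coefficient is largest, every member lies on a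
    proportion of at least \<open>1 / M\<close> of all chains, as in the LYM inequality.\<close>
  have "real (fact n) \<le> t X * M" if "X \<in> F" for X
  proof -
    have "fact n \<le> card (through n X) * M"
      using card_through[OF ground[OF that]] binomial_maximum[of n "card X"]
      by (metis M_def mult_le_mono2)
    then show ?thesis unfolding t_def by (metis of_nat_le_iff of_nat_mult)
  qed
  then have "(\<Sum>X\<in>F. real (fact n)) \<le> (\<Sum>X\<in>F. t X * M)" by (rule sum_mono)
  then have "card F * real (fact n) \<le> V * M" by (simp add: V_def sum_distrib_right)
  moreover have "(1 + \<epsilon>) * M * real (fact n) \<le> card F * real (fact n)"
    using card by (intro mult_right_mono) (auto simp: M_def)
  ultimately have "M * ((1 + \<epsilon>) * real (fact n)) \<le> M * V" by (simp add: algebra_simps)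
  then have V: "(1 + \<epsilon>) * real (fact n) \<le> V" using M by simp
  have Vpos: "0 < V" using V eps by (smt (verit) fact_gt_zero mult_pos_pos of_nat_0_less_iff)
  have "real (fact n) \<le> V / (1 + \<epsilon>)" using V eps by (simp add: field_simps)
  moreover have "V - V / (1 + \<epsilon>) = 3 * \<delta> * V" using eps by (simp add: \<delta>_def field_simps)
  moreover have "V \<le> real (fact n) + sum w E"
  proof -
    have "real (\<Sum>X\<in>F. card (through n X))
      \<le> real (fact n + (\<Sum>(X, Y)\<in>E. card (consec n F X Y)))"
      using sum_card_through_le[OF fF, of n] unfolding E_def by (rule of_nat_mono)
    then show ?thesis by (simp add: V_def t_def[abs_def] w_def[abs_def] case_prod_unfold)
  qed
  ultimately have sw: "3 * \<delta> * V \<le> sum w E" by linarith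
  have *: "sum (\<lambda>X. \<delta> * t X) S \<le> \<delta> * V" if "S \<subseteq> F" for S
    using \<delta> that fF unfolding V_def sum_distrib_left by (intro sum_mono2) (auto simp: t_def)
  have "fst ` E \<subseteq> F" "snd ` E \<subseteq> F" by (auto simp: E_def)
  then have "sum (\<lambda>X. \<delta> * t X) (fst ` E) + sum (\<lambda>X. \<delta> * t X) (snd ` E) \<le> 2 * \<delta> * V"
    using *[of "fst ` E"] *[of "snd ` E"] by simp
  also have "2 * \<delta> * V < 3 * \<delta> * V" using \<delta> Vpos by simp
  finally have "sum (\<lambda>X. \<delta> * t X) (fst ` E) + sum (\<lambda>X. \<delta> * t X) (snd ` E) < sum w E" using sw by linarith
  then obtain H where H: "H \<subseteq> E" "H \<noteq> {}"
    and up: "\<And>X Y. (X, Y) \<in> H \<Longrightarrow> \<delta> * t X \<le> (\<Sum>Y' | (X, Y') \<in> H. w (X, Y'))"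
    and down: "\<And>X Y. (X, Y) \<in> H \<Longrightarrow> \<delta> * t Y \<le> (\<Sum>X' | (X', Y) \<in> H. w (X', Y))"
    using fE \<delta> by (elim ex_min_degree_subgraph[rotated]) (auto simp: t_def)
  have "dense_pairs n D \<delta> F H"
  proof
    fix X Y assume XY: "(X, Y) \<in> H"
    show "X \<in> F \<and> Y \<in> F \<and> X \<subset> Y" using XY H(1) by (auto simp: E_def)
    show "\<delta> * card (through n X) \<le> (\<Sum>Y' | (X, Y') \<in> H. card (consec n F X Y'))"
      using up[OF XY] by (simp add: t_def w_def)
    show "\<delta> * card (through n Y) \<le> (\<Sum>X' | (X', Y) \<in> H. card (consec n F X' Y))"
      using down[OF XY] by (simp add: t_def w_def)
  qed (use ground ge le spread \<delta> H in auto)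
  then show ?thesis unfolding \<delta>_def by blast
qed

section \<open>The fence as a zigzag\<close>

text \<open>Position along the path \<open>A 1, B 1, A 2, ..., B (k - 1), A k\<close>, counted from
  0, so that lower elements are at even positions.\<close>

definition fence_pos :: "fence_elem \<Rightarrow> nat" where
  "fence_pos p = (case p of A i \<Rightarrow> 2 * i - 2 | B i \<Rightarrow> 2 * i - 1)"

lemma fence_pos_Suc [simp]: "fence_pos (A (Suc i)) = 2 * i" "fence_pos (B (Suc i)) = Suc (2 * i)"
  by (simp_all add: fence_pos_def)

text \<open>Writing indices as successors removes the subtractions from
  \<open>fence_pos\<close>.\<close>

lemma fence_cases:
  assumes "p \<in> fence k"
  obtains i where "p = A (Suc i)" "i < k" | i where "p = B (Suc i)" "Suc i < k"
proof (cases p)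
  case (A i)
  then have "1 \<le> i" "i \<le> k" using assms by (auto simp: fence_def)
  then show ?thesis using that(1)[of "i - 1"] A by simp
next
  case (B i)
  then have "1 \<le> i" "i \<le> k - 1" using assms by (auto simp: fence_def)
  then show ?thesis using that(2)[of "i - 1"] B by simp
qed

lemma fence_pos_le: "p \<in> fence k \<Longrightarrow> fence_pos p \<le> 2 * k - 2"
  by (erule fence_cases) auto

lemma fence_order_iff:
  assumes "p \<in> fence k" "q \<in> fence k"
  shows "(p, q) \<in> fence_order k \<longleftrightarrow> fence_pos p = fence_pos q \<or>
    even (fence_pos p) \<and> odd (fence_pos q) \<and>
      (fence_pos q = fence_pos p + 1 \<or> fence_pos p = fence_pos q + 1)"
  using assms
  by (elim fence_cases; simp add: fence_order_def fence_def Id_on_def; presburger)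

lemma fence_pos_inj:
  assumes "p \<in> fence k" "q \<in> fence k" "fence_pos p = fence_pos q"
  shows "p = q"
  using assms by (elim fence_cases; simp; presburger)

text \<open>The order of positions is that of the fence, and injectivity follows from antisymmetry:
  no two distinct positions are related both ways.\<close>

lemma strong_copy_via_zigzag:
  assumes rel: "\<forall>r\<le>2 * k - 2. \<forall>r'\<le>2 * k - 2.
    P r \<subseteq> P r' \<longleftrightarrow> r = r' \<or> even r \<and> odd r' \<and> (r' = r + 1 \<or> r = r' + 1)"
  shows "strong_copy_via (fence k) (fence_order k) (P \<circ> fence_pos) ((P \<circ> fence_pos) ` fence k)"
proof -
  have inj: "r = r'" if "r \<le> 2 * k - 2" "r' \<le> 2 * k - 2" "P r = P r'" for r r'
    using rel[rule_format, OF that(1,2)] rel[rule_format, OF that(2,1)] that(3) by auto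
  have "inj_on (P \<circ> fence_pos) (fence k)"
    using inj fence_pos_le fence_pos_inj by (intro inj_onI) (metis comp_apply)
  then have "bij_betw (P \<circ> fence_pos) (fence k) ((P \<circ> fence_pos) ` fence k)"
    by (rule inj_on_imp_bij_betw)
  moreover have "(p, q) \<in> fence_order k \<longleftrightarrow> (P \<circ> fence_pos) p \<subseteq> (P \<circ> fence_pos) q"
    if "p \<in> fence k" "q \<in> fence k" for p q
    unfolding comp_apply fence_order_iff[OF that]
    by (rule rel[rule_format, symmetric]) (use that fence_pos_le in auto)
  ultimately show ?thesis unfolding strong_copy_via_def by blast
qed

section \<open>Choice of the parameters\<close>

theorem theorem2p2:
  fixes k :: nat and \<epsilon> :: real
  assumes "k \<ge> 3" and "\<epsilon> > 0"
  shows "\<exists>n\<^sub>0::nat. \<forall>n\<ge>n\<^sub>0. \<forall>F :: nat set set.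
    F \<subseteq> B_tilde n \<and> real (card F) = (1 + \<epsilon>) * real (n choose (n div 2)) \<longrightarrow>
    (\<exists>G f. G \<subseteq> F \<and> strong_copy_via (fence k) (fence_order k) f G \<and>
      (\<forall>i\<in>{2..k - 1}. \<not> f (A i) \<subseteq> f (A 1) \<union> f (A k)))"
proof -
  define \<delta> where "\<delta> = \<epsilon> / (3 * (1 + \<epsilon>))"
  have \<delta>: "0 < \<delta>" using assms(2) by (simp add: \<delta>_def)
  obtain m :: nat where m: "16 < m * \<delta>"
    using reals_Archimedean3[OF \<delta>] by blast
  \<comment> \<open>Two legs and the centre give \<open>2 * L + 1\<close> sets, and the two added
    ends make \<open>2 * k - 1\<close>.\<close>
  define L where "L = k - 2"
  define K where "K = 32 * real (m * L + 1) * real (m * L + 1)"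
  have "0 < real (m * L + 1)" by (simp only: of_nat_0_less_iff)
  then have K: "0 < K" unfolding K_def by (intro mult_pos_pos) simp_all
  define s where "s n = sqrt (real n * ln (real n))" for n
  \<comment> \<open>Sizes lie within \<open>2 * s n\<close> of \<open>n / 2\<close>. The threshold
    \<open>1 / 8\<close> places them between \<open>n / 4\<close> and \<open>3 * n / 4\<close>; the
    threshold \<open>\<delta> / (4 * K)\<close> gives \<open>K * D \<le> \<delta> * n\<close>, as
    \<open>D \<le> 4 * s n\<close>.\<close>
  have lim: "(\<lambda>n. s n / real n) \<longlonglongrightarrow> 0" unfolding s_def by real_asymp
  have "\<forall>\<^sub>F n in sequentially. s n / real n < 1 / 8"
    using order_tendstoD(2)[OF lim, of "1 / 8"] by simp
  moreover have "\<forall>\<^sub>F n in sequentially. s n / real n < \<delta> / (4 * K)"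
    using order_tendstoD(2)[OF lim, of "\<delta> / (4 * K)"] \<delta> K by simp
  ultimately have "\<forall>\<^sub>F n in sequentially. s n / real n < 1 / 8 \<and> s n / real n < \<delta> / (4 * K) \<and> 0 < n"
    using eventually_gt_at_top[of 0] by eventually_elim simp
  then obtain n\<^sub>0 where n0: "\<And>n. n \<ge> n\<^sub>0 \<Longrightarrow> s n / real n < 1 / 8 \<and> s n / real n < \<delta> / (4 * K) \<and> 0 < n"
    by (auto simp: eventually_sequentially)
  show ?thesis
  proof (intro exI[of _ n\<^sub>0] allI impI)
    fix n :: nat and F :: "nat set set"
    assume n: "n\<^sub>0 \<le> n" and F: "F \<subseteq> B_tilde n \<and> real (card F) = (1 + \<epsilon>) * real (n choose (n div 2))"
    have npos: "0 < n" and s8: "8 * s n \<le> n" using n0[OF n] by (auto simp: field_simps)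
    have "s n / n < \<delta> / (4 * K)" using n0[OF n] by simp
    then have sK: "K * (4 * s n) \<le> \<delta> * n" using K npos by (simp add: field_simps)
    define D where "D = nat \<lfloor>4 * s n\<rfloor>"
    have mem: "X \<subseteq> {1..n}" "\<bar>real (card X) - real n / 2\<bar> \<le> 2 * s n" if "X \<in> F" for X
      using that F by (auto simp: B_tilde_def s_def)
    have "0 \<le> s n" using npos by (simp add: s_def)
    then have "real D \<le> 4 * s n" by (simp add: D_def)
    then have "K * D \<le> \<delta> * n" using K sK by (smt (verit) mult_left_mono)
    then have small: "32 * real (m * L + 1) * real (m * L + 1) * D \<le> \<delta> * n" by (simp add: K_def)
    have "\<exists>H. dense_pairs n D (\<epsilon> / (3 * (1 + \<epsilon>))) F H"
    proof (rule ex_dense_pairs)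
      fix X assume X: "X \<in> F"
      show "X \<subseteq> {1..n}" using mem X by blast
      have "real n \<le> 4 * real (card X)" "4 * real (card X) \<le> 3 * real n"
        using mem(2)[OF X] s8 by linarith+
      then show "n \<le> 4 * card X" "4 * card X \<le> 3 * n" by linarith+
      fix Y assume Y: "Y \<in> F"
      have "real (card Y) - real (card X) \<le> 4 * s n" using mem(2)[OF X] mem(2)[OF Y] by linarith
      then show "card Y \<le> card X + D" unfolding D_def by linarith
    qed (use F assms in auto)
    then obtain H where "dense_pairs n D \<delta> F H" by (auto simp: \<delta>_def)
    then interpret dense_pairs n D \<delta> F H .
    have L: "0 < L" "2 * L + 2 = 2 * k - 2" "2 * L + 1 = 2 * k - 3" using assms(1) by (auto simp: L_def)
    obtain P y where P: "\<forall>r\<le>2 * k - 2. P r \<in> F"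
      and rel: "\<forall>r\<le>2 * k - 2. \<forall>r'\<le>2 * k - 2.
        P r \<subseteq> P r' \<longleftrightarrow> r = r' \<or> even r \<and> odd r' \<and> (r' = r + 1 \<or> r = r' + 1)"
      and y: "y \<notin> P 0" "y \<notin> P (2 * k - 2)" "\<forall>r\<in>{1..2 * k - 3}. y \<in> P r"
      using ex_zigzag[OF L(1) m small] unfolding L by (elim exE conjE)
    let ?f = "P \<circ> fence_pos"
    have "?f ` fence k \<subseteq> F" using P fence_pos_le by auto
    moreover have "\<not> ?f (A i) \<subseteq> ?f (A 1) \<union> ?f (A k)" if "i \<in> {2..k - 1}" for i
    proof -
      \<comment> \<open>The elements \<open>A i\<close> with \<open>2 \<le> i \<le> k - 1\<close>
        sit at inner positions, whose sets contain \<open>y\<close>, whereas \<open>A 1\<close> and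
        \<open>A k\<close> are the two ends, which omit it.\<close>
      have "2 * i - 2 \<in> {1..2 * k - 3}" using that by auto
      then have "y \<in> P (2 * i - 2)" using y(3) by blast
      then show ?thesis using y(1,2) by (auto simp: fence_pos_def)
    qed
    ultimately show "\<exists>G f. G \<subseteq> F \<and> strong_copy_via (fence k) (fence_order k) f G \<and>
        (\<forall>i\<in>{2..k - 1}. \<not> f (A i) \<subseteq> f (A 1) \<union> f (A k))"
      using strong_copy_via_zigzag[OF rel] by blast
  qed
qed

end
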